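(* Let $\alpha>0$ and let $x_0>0$ be such that $K_\alpha(\sqrt{x_0})=1$. Then the function $\Delta_\alpha(x)=\dfrac{-1}{\ln\left(K_\alpha(\sqrt{x})\right)}$ is logarithmically completely monotonic on $]x_0,\infty[$.
   Context: $K_\alpha$ is the modified Bessel function of the second kind, $K_\alpha(x)=\int_0^{\infty}e^{-x\cosh t}\cosh(\alpha t)\,dt$ for $x>0$. A function $f$ is logarithmically completely monotonic on an open interval $I$ if $f>0$ on $I$, $f$ has derivatives of all orders on $I$, and $(-1)^n[\ln f(x)]^{(n)}\ge0$ for all $x\in I$ and all integers $n\ge1$. *)

theory Defs
  imports "HOL-Analysis.Analysis"
begin

(* Only meaningful for x > 0, where the integrand is Lebesgue integrable. *)
definition bessel_K :: "real \<Rightarrow> real \<Rightarrow> real" where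
  "bessel_K \<alpha> x = (LBINT t:{0..}. exp (- x * cosh t) * cosh (\<alpha> * t))"

(* Intended for open intervals I: "deriv" is the two-sided derivative, so on an open set the
   iterates (deriv ^^ n) at points of I depend only on the values of the function on I. *)
definition log_completely_monotonic_on :: "(real \<Rightarrow> real) \<Rightarrow> real set \<Rightarrow> bool" where
  "log_completely_monotonic_on f I \<longleftrightarrow>
     (\<forall>x\<in>I. f x > 0) \<and>
     (\<forall>n. \<forall>x\<in>I. (deriv ^^ n) f field_differentiable (at x)) \<and>
     (\<forall>n\<ge>1. \<forall>x\<in>I. (- 1) ^ n * (deriv ^^ n) (\<lambda>y. ln (f y)) x \<ge> 0)"

definition bessel_Delta :: "real \<Rightarrow> real \<Rightarrow> real" where
  "bessel_Delta \<alpha> x = - 1 / ln (bessel_K \<alpha> (sqrt x))"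

end

theory Submission
  imports Defs
begin

text \<open>
  Put \<open>u x = K\<^sub>\<alpha> (sqrt x)\<close> and \<open>h = - ln u\<close>, so that \<open>\<Delta>\<^sub>\<alpha> = 1 / h\<close>, with \<open>h > 0\<close> on
  \<open>]x\<^sub>0, \<infinity>[\<close> because \<open>K\<^sub>\<alpha>\<close> decreases. Everything follows once \<open>h'\<close> is known to be completely
  monotonic: then so is \<open>1 / h\<close>, since \<open>(1 / h)' = - h' (1 / h) (1 / h)\<close> determines the signs of its
  derivatives inductively, and hence so is the product \<open>h' / h = - (ln \<Delta>\<^sub>\<alpha>)'\<close>. This is
  \<open>alternating_inverse\<close> and \<open>log_completely_monotonic_on_inverse\<close>.

  Classically the complete monotonicity of \<open>h'\<close> is read off from Grosswald's integral
  representation of \<open>K\<^bsub>\<alpha>-1\<^esub> / K\<^sub>\<alpha>\<close>. The argument below stays on the real line and uses only the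
  differential equation. Let \<open>v x = - x u'(x) / u x\<close>, so that \<open>h' = v / x\<close>. The modified Bessel
  equation becomes the Riccati equation \<open>x v' = v\<^sup>2 - (x + \<alpha>\<^sup>2) / 4\<close>. Differentiating it \<open>n \<ge> 1\<close>
  times and writing \<open>W\<^sub>n = (-1)\<^bsup>n-1\<^esup> v\<^bsup>(n)\<^esup>\<close> gives
    \<open>x W\<^sub>n' + (n - 2 v) W\<^sub>n = - S\<^sub>n\<close>,
  where \<open>S\<^sub>n\<close> is a combination of products \<open>W\<^sub>k W\<^bsub>n-k\<^esub>\<close> with \<open>0 < k < n\<close> and positive coefficients,
  to which \<open>1 / 4\<close> is added if \<open>n = 1\<close>. By induction \<open>S\<^sub>n \<ge> 0\<close>. An integrating factor is
  \<open>x\<^sup>n u\<^sup>2\<close>, because \<open>u' = - u v / x\<close>: the function \<open>x\<^sup>n u\<^sup>2 W\<^sub>n\<close> is nonincreasing, and it tends to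
  \<open>0\<close> at infinity because \<open>u\<close> decays like \<open>exp (- sqrt x)\<close> while \<open>W\<^sub>n\<close> is polynomially bounded.
  Hence \<open>W\<^sub>n \<ge> 0\<close>, that is, \<open>v'\<close> is completely monotonic (\<open>sderiv_nonneg\<close>). Since moreover
  \<open>v \<ge> 0\<close>, Taylor's formula shows that \<open>v / x\<close> is completely monotonic
  (\<open>alternating_quotient\<close>).

  What has to be checked about \<open>K\<^sub>\<alpha>\<close> itself (\<open>bessel_K_sqrt_riccati\<close>) is the Bessel equation, by
  differentiation under the integral sign and an integration by parts, the exponential decay, and
  the growth of \<open>v\<close>, which comes from the Cauchy-Schwarz inequality \<open>K'\<^sup>2 \<le> K K''\<close>.
\<close>

section \<open>Functions with derivatives of alternating sign\<close>

text \<open>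
  With \<open>s = 1\<close> this is complete monotonicity up to order \<open>n\<close>. The order is made explicit so that
  closure properties follow by induction on it, without Leibniz or Faa di Bruno formulas; the
  sign \<open>s\<close> flips at each differentiation.
\<close>
primrec alternating :: "nat \<Rightarrow> real set \<Rightarrow> real \<Rightarrow> (real \<Rightarrow> real) \<Rightarrow> bool" where
  "alternating 0 S s f \<longleftrightarrow> (\<forall>x\<in>S. 0 \<le> s * f x)"
| "alternating (Suc n) S s f \<longleftrightarrow> (\<forall>x\<in>S. 0 \<le> s * f x) \<and>
     (\<exists>f'. (\<forall>x\<in>S. (f has_real_derivative f' x) (at x)) \<and> alternating n S (- s) f')"

lemma alternating_Suc_imp: "alternating (Suc n) S s f \<Longrightarrow> alternating n S s f"
proof (induction n arbitrary: s f)
  case (Suc n)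
  then obtain f' where "\<forall>x\<in>S. (f has_real_derivative f' x) (at x)" "alternating (Suc n) S (- s) f'"
    "\<forall>x\<in>S. 0 \<le> s * f x"
    by (subst (asm) (3) alternating.simps(2)) blast
  with Suc.IH[of "- s" f'] show ?case by auto
qed auto

lemma alternating_SucI:
  assumes "\<And>x. x \<in> S \<Longrightarrow> 0 \<le> s * f x"
    and "\<And>x. x \<in> S \<Longrightarrow> (f has_real_derivative f' x) (at x)"
    and "alternating n S (- s) f'"
  shows "alternating (Suc n) S s f"
  using assms by auto

lemma alternating_sign: "alternating n S s f \<Longrightarrow> x \<in> S \<Longrightarrow> 0 \<le> s * f x"
  by (cases n) auto

lemma alternating_subset: "alternating n S s f \<Longrightarrow> T \<subseteq> S \<Longrightarrow> alternating n T s f"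
proof (induction n arbitrary: s f)
  case (Suc n)
  then obtain f' where "\<forall>x\<in>S. (f has_real_derivative f' x) (at x)" "alternating n S (- s) f'"
    by auto
  with Suc show ?case by (auto intro!: exI[of _ f'])
qed auto

lemma alternating_uminus: "alternating n S s f \<Longrightarrow> alternating n S (- s) (\<lambda>x. - f x)"
proof (induction n arbitrary: s f)
  case (Suc n)
  then obtain f' where f': "\<forall>x\<in>S. (f has_real_derivative f' x) (at x)" "alternating n S (- s) f'"
    by auto
  have "\<forall>x\<in>S. ((\<lambda>x. - f x) has_real_derivative - f' x) (at x)"
    using f'(1) by (auto intro!: derivative_eq_intros)
  with Suc.IH[OF f'(2)] Suc.prems show ?case by auto
qed auto

lemma alternating_add:
  "alternating n S s f \<Longrightarrow> alternating n S s g \<Longrightarrow> alternating n S s (\<lambda>x. f x + g x)"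
proof (induction n arbitrary: s f g)
  case 0
  then show ?case by (auto simp: distrib_left)
next
  case (Suc n)
  then obtain f' g' where
    f': "\<forall>x\<in>S. (f has_real_derivative f' x) (at x)" "alternating n S (- s) f'" and
    g': "\<forall>x\<in>S. (g has_real_derivative g' x) (at x)" "alternating n S (- s) g'"
    by auto
  have "\<forall>x\<in>S. ((\<lambda>x. f x + g x) has_real_derivative f' x + g' x) (at x)"
    using f'(1) g'(1) by (auto intro!: derivative_intros)
  moreover have "\<forall>x\<in>S. 0 \<le> s * (f x + g x)"
    using Suc.prems by (auto simp: distrib_left)
  ultimately show ?case using Suc.IH[OF f'(2) g'(2)] by auto
qed

lemma alternating_mult:
  "alternating n S s f \<Longrightarrow> alternating n S t g \<Longrightarrow> alternating n S (s * t) (\<lambda>x. f x * g x)"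
proof (induction n arbitrary: s t f g)
  case 0
  then show ?case by (auto simp: mult_ac intro: mult_nonneg_nonneg[of "s * f _" "t * g _", simplified mult_ac])
next
  case (Suc n)
  then obtain f' g' where
    f': "\<forall>x\<in>S. (f has_real_derivative f' x) (at x)" "alternating n S (- s) f'" and
    g': "\<forall>x\<in>S. (g has_real_derivative g' x) (at x)" "alternating n S (- t) g'"
    by auto
  have "\<forall>x\<in>S. ((\<lambda>x. f x * g x) has_real_derivative f' x * g x + f x * g' x) (at x)"
    using f'(1) g'(1) by (auto intro!: derivative_eq_intros)
  moreover have "alternating n S (- (s * t)) (\<lambda>x. f' x * g x + f x * g' x)"
    using alternating_add[OF Suc.IH[OF f'(2) alternating_Suc_imp[OF Suc.prems(2)], simplified]
        Suc.IH[OF alternating_Suc_imp[OF Suc.prems(1)] g'(2), simplified]] by simp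
  moreover have "\<forall>x\<in>S. 0 \<le> s * t * (f x * g x)"
  proof
    fix x assume "x \<in> S"
    then have "0 \<le> (s * f x) * (t * g x)"
      using Suc.prems by (intro mult_nonneg_nonneg[of "s * f x" "t * g x"]) auto
    then show "0 \<le> s * t * (f x * g x)" by (simp add: mult_ac)
  qed
  ultimately show ?case by auto
qed

text \<open>
  The derivative \<open>- b (1 / h) (1 / h)\<close> contains \<open>1 / h\<close> only to the order that the induction
  hypothesis already covers.
\<close>
lemma alternating_inverse:
  assumes "\<And>x. x \<in> S \<Longrightarrow> 0 < h x"
    and "\<And>x. x \<in> S \<Longrightarrow> (h has_real_derivative b x) (at x)"
    and "\<And>n. alternating n S 1 b"
  shows "alternating n S 1 (\<lambda>x. 1 / h x)"
proof (induction n)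
  case 0
  then show ?case using assms(1) by (auto simp: less_imp_le)
next
  case (Suc n)
  have "\<forall>x\<in>S. ((\<lambda>x. 1 / h x) has_real_derivative - (b x * (1 / h x * (1 / h x)))) (at x)"
    using assms(1,2) by (auto intro!: derivative_eq_intros simp: less_imp_neq[symmetric])
  moreover have "alternating n S (- 1) (\<lambda>x. - (b x * (1 / h x * (1 / h x))))"
    using alternating_uminus[OF alternating_mult[OF assms(3) alternating_mult[OF Suc Suc]]] by simp
  moreover have "\<forall>x\<in>S. 0 \<le> 1 * (1 / h x)"
    using assms(1) by (auto simp: less_imp_le)
  ultimately show ?case by (intro alternating_SucI) auto
qed

text \<open>
  A sequence of nonnegative functions, each of which is minus the derivative of its predecessor,
  exhibits its members as completely monotonic.
\<close>
lemma alternating_sequence: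
  assumes "\<And>i x. x \<in> S \<Longrightarrow> (D i has_real_derivative - D (Suc i) x) (at x)"
    and "\<And>i x. x \<in> S \<Longrightarrow> 0 \<le> D i x"
  shows "alternating n S 1 (D i)"
proof (induction n arbitrary: i)
  case 0
  then show ?case using assms(2) by auto
next
  case (Suc n)
  have "\<forall>x\<in>S. (D i has_real_derivative - D (Suc i) x) (at x)"
    using assms(1) by blast
  moreover have "alternating n S (- 1) (\<lambda>x. - D (Suc i) x)"
    by (rule alternating_uminus[OF Suc])
  ultimately show ?case using assms(2) by (intro alternating_SucI) auto
qed

lemma alternating_cong:
  assumes "open S" "\<And>x. x \<in> S \<Longrightarrow> f x = g x" "alternating n S s f"
  shows "alternating n S s g"
proof (cases n)
  case 0
  with assms show ?thesis by auto
next
  case (Suc m)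
  then obtain f' where f': "\<forall>x\<in>S. (f has_real_derivative f' x) (at x)" "alternating m S (- s) f'"
    using assms(3) by auto
  have "\<forall>x\<in>S. (g has_real_derivative f' x) (at x)"
    using f'(1) assms(1,2) by (auto intro: has_field_derivative_transform_within_open)
  with f' Suc assms show ?thesis by auto
qed

lemma alternating_deriv:
  assumes "open S" "alternating (Suc n) S s f"
  shows "alternating n S (- s) (deriv f)"
proof -
  obtain f' where f': "\<forall>x\<in>S. (f has_real_derivative f' x) (at x)" "alternating n S (- s) f'"
    using assms(2) by auto
  show ?thesis
    by (rule alternating_cong[OF assms(1) _ f'(2)]) (use f'(1) in \<open>auto dest: DERIV_imp_deriv[symmetric]\<close>)
qed

lemma alternating_iterated_deriv:
  assumes "open S" "alternating (k + n) S s f"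
  shows "alternating k S ((- 1) ^ n * s) ((deriv ^^ n) f)"
  using assms(2)
proof (induction n arbitrary: s f)
  case (Suc n)
  have "alternating (k + n) S (- s) (deriv f)"
    using alternating_deriv[OF assms(1)] Suc.prems by simp
  from Suc.IH[OF this] show ?case
    by (simp add: funpow_swap1)
qed simp

section \<open>Polynomially bounded functions\<close>

definition poly_growth :: "(real \<Rightarrow> real) \<Rightarrow> bool" where
  "poly_growth f \<longleftrightarrow> (\<exists>C m. 0 \<le> C \<and> (\<forall>x\<ge>1. \<bar>f x\<bar> \<le> C * x ^ m))"

lemma poly_growth_const: "poly_growth (\<lambda>x. c)"
  unfolding poly_growth_def by (rule exI[of _ "\<bar>c\<bar>"], rule exI[of _ 0]) auto

lemma poly_growth_ident: "poly_growth (\<lambda>x. x)"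
  unfolding poly_growth_def by (rule exI[of _ 1], rule exI[of _ 1]) auto

lemma poly_growth_mult:
  assumes "poly_growth f" "poly_growth g"
  shows "poly_growth (\<lambda>x. f x * g x)"
proof -
  obtain C m D l where *: "0 \<le> C" "\<forall>x\<ge>1. \<bar>f x\<bar> \<le> C * x ^ m" "0 \<le> D" "\<forall>x\<ge>1. \<bar>g x\<bar> \<le> D * x ^ l"
    using assms unfolding poly_growth_def by blast
  have "\<bar>f x * g x\<bar> \<le> (C * D) * x ^ (m + l)" if "x \<ge> 1" for x
  proof -
    have "\<bar>f x\<bar> * \<bar>g x\<bar> \<le> (C * x ^ m) * (D * x ^ l)"
      using * that by (intro mult_mono) auto
    then show ?thesis by (simp add: abs_mult power_add mult_ac)
  qed
  then show ?thesis unfolding poly_growth_def using * by (intro exI[of _ "C * D"] exI[of _ "m + l"]) auto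
qed

lemma poly_growth_add:
  assumes "poly_growth f" "poly_growth g"
  shows "poly_growth (\<lambda>x. f x + g x)"
proof -
  obtain C m D l where *: "0 \<le> C" "\<forall>x\<ge>1. \<bar>f x\<bar> \<le> C * x ^ m" "0 \<le> D" "\<forall>x\<ge>1. \<bar>g x\<bar> \<le> D * x ^ l"
    using assms unfolding poly_growth_def by blast
  have "\<bar>f x + g x\<bar> \<le> (C + D) * x ^ (m + l)" if "x \<ge> 1" for x
  proof -
    have "x ^ m \<le> x ^ (m + l)" "x ^ l \<le> x ^ (m + l)"
      using that by (auto intro: power_increasing)
    then have "C * x ^ m \<le> C * x ^ (m + l)" "D * x ^ l \<le> D * x ^ (m + l)"
      using * by (auto intro: mult_left_mono)
    moreover have "\<bar>f x\<bar> \<le> C * x ^ m" "\<bar>g x\<bar> \<le> D * x ^ l"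
      using * that by auto
    ultimately show ?thesis unfolding distrib_right by linarith
  qed
  then show ?thesis unfolding poly_growth_def using * by (intro exI[of _ "C + D"] exI[of _ "m + l"]) auto
qed

lemma poly_growth_uminus: "poly_growth f \<Longrightarrow> poly_growth (\<lambda>x. - f x)"
  unfolding poly_growth_def by simp

lemma poly_growth_sum:
  "(\<And>k. k \<in> A \<Longrightarrow> poly_growth (f k)) \<Longrightarrow> poly_growth (\<lambda>x. \<Sum>k\<in>A. f k x)"
  by (induction A rule: infinite_finite_induct) (auto intro: poly_growth_add poly_growth_const)

lemma poly_growth_divide_ident:
  assumes "poly_growth f"
  shows "poly_growth (\<lambda>x. f x / x)"
proof -
  have "poly_growth (\<lambda>x. 1 / x)"
    unfolding poly_growth_def
    by (rule exI[of _ 1], rule exI[of _ 0]) auto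
  from poly_growth_mult[OF assms this] show ?thesis by simp
qed

section \<open>Riccati equations with a completely monotonic derivative\<close>

text \<open>
  The induction step of the Leibniz rule for the \<open>n\<close>-th derivative of a product, where
  \<open>a k\<close> and \<open>b k\<close> stand for the \<open>k\<close>-th derivatives of the factors at a point.
\<close>
lemma sum_binomial_Leibniz:
  fixes a b :: "nat \<Rightarrow> real"
  shows "(\<Sum>k\<le>n. real (n choose k) * (a (Suc k) * b (n - k) + a k * b (Suc (n - k))))
       = (\<Sum>k\<le>Suc n. real (Suc n choose k) * (a k * b (Suc n - k)))"
proof -
  have "(\<Sum>k\<le>Suc n. real (Suc n choose k) * (a k * b (Suc n - k)))
      = a 0 * b (Suc n) + (\<Sum>k\<le>n. real (Suc n choose Suc k) * (a (Suc k) * b (n - k)))"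
    by (subst sum.atMost_Suc_shift) simp
  also have "\<dots> = a 0 * b (Suc n) + (\<Sum>k\<le>n. real (n choose Suc k) * (a (Suc k) * b (n - k)))
      + (\<Sum>k\<le>n. real (n choose k) * (a (Suc k) * b (n - k)))"
    by (simp add: distrib_right sum.distrib)
  also have "a 0 * b (Suc n) + (\<Sum>k\<le>n. real (n choose Suc k) * (a (Suc k) * b (n - k)))
      = (\<Sum>k\<le>Suc n. real (n choose k) * (a k * b (Suc n - k)))"
    by (subst sum.atMost_Suc_shift) simp
  also have "\<dots> = (\<Sum>k\<le>n. real (n choose k) * (a k * b (Suc (n - k))))"
    by (simp add: binomial_eq_0 Suc_diff_le)
  finally show ?thesis by (simp add: sum.distrib distrib_left)
qed

text \<open>
  The function \<open>u\<close> is a positive, rapidly decaying solution of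
  \<open>(x d/dx)\<^sup>2 u = (p x + q) u\<close>, and \<open>v = - x u' / u\<close> is its logarithmic derivative, which solves the
  Riccati equation \<open>x v' = v\<^sup>2 - p x - q\<close>.
\<close>
locale riccati =
  fixes u v :: "real \<Rightarrow> real" and p q :: real
  assumes p_nonneg: "0 \<le> p"
    and u_deriv: "\<And>x. 0 < x \<Longrightarrow> (u has_real_derivative - u x * v x / x) (at x)"
    and v_deriv: "\<And>x. 0 < x \<Longrightarrow> (v has_real_derivative ((v x)\<^sup>2 - p * x - q) / x) (at x)"
    and u_pos: "\<And>x. 0 < x \<Longrightarrow> 0 < u x"
    and v_nonneg: "\<And>x. 0 < x \<Longrightarrow> 0 \<le> v x"
    and v_growth: "poly_growth v"
    and u_decay: "\<And>m. ((\<lambda>x. x ^ m * (u x)\<^sup>2) \<longlongrightarrow> 0) at_top"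
begin

text \<open>
  \<open>(-1)\<^sup>n\<close> times the \<open>n\<close>-th derivative of the inhomogeneous term \<open>p x + q\<close>.
\<close>
definition forcing :: "nat \<Rightarrow> real \<Rightarrow> real" where
  "forcing n x = (if n = 0 then p * x + q else if n = 1 then - p else 0)"

text \<open>
  \<open>sderiv n\<close> is \<open>(-1)\<^bsup>n-1\<^esup>\<close> times the \<open>n\<close>-th derivative of \<open>v\<close>. The recursion is the Riccati equation
  differentiated \<open>n\<close> times and solved for the highest derivative. Taking it as the definition
  produces all derivatives of \<open>v\<close> explicitly, so that smoothness (\<open>sderiv_deriv\<close>) and polynomial
  growth (\<open>sderiv_growth\<close>) are obtained by induction.
\<close>
fun sderiv :: "nat \<Rightarrow> real \<Rightarrow> real" where
  "sderiv 0 x = - v x"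
| "sderiv (Suc n) x = (real n * sderiv n x + (\<Sum>k\<le>n. real (n choose k) * (sderiv k x * sderiv (n - k) x)) - forcing n x) / x"

declare sderiv.simps(2) [simp del]

lemma sderiv_recursion:
  "0 < x \<Longrightarrow> x * sderiv (Suc n) x = real n * sderiv n x + (\<Sum>k\<le>n. real (n choose k) * (sderiv k x * sderiv (n - k) x)) - forcing n x"
  by (simp add: sderiv.simps(2))

lemma sderiv_deriv: "0 < x \<Longrightarrow> (sderiv n has_real_derivative - sderiv (Suc n) x) (at x)"
proof (induction n arbitrary: x rule: less_induct)
  case (less n)
  show ?case
  proof (cases n)
    case 0
    have "sderiv 0 = (\<lambda>x. - v x)" by auto
    then show ?thesis
      using less.prems 0
      by (auto intro!: derivative_eq_intros v_deriv simp: sderiv.simps(2) forcing_def power2_eq_square divide_simps)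
  next
    case (Suc m)
    define R where "R = (\<lambda>x. real m * sderiv m x + (\<Sum>k\<le>m. real (m choose k) * (sderiv k x * sderiv (m - k) x)) - forcing m x)"
    have forcing: "(forcing m has_real_derivative - forcing (Suc m) x) (at x)"
      by (cases m) (auto simp: forcing_def[abs_def] intro!: derivative_eq_intros)
    have IH: "(sderiv k has_real_derivative - sderiv (Suc k) x) (at x)" if "k \<le> m" for k
      using less Suc that by auto
    have "(R has_real_derivative real m * (- sderiv (Suc m) x)
        + (\<Sum>k\<le>m. real (m choose k) * ((- sderiv (Suc k) x) * sderiv (m - k) x + (- sderiv (Suc (m - k)) x) * sderiv k x))
        - (- forcing (Suc m) x)) (at x)"
      unfolding R_def
      by (intro derivative_intros DERIV_cmult DERIV_sum DERIV_mult' DERIV_mult IH forcing) auto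
    also have "(\<Sum>k\<le>m. real (m choose k) * ((- sderiv (Suc k) x) * sderiv (m - k) x + (- sderiv (Suc (m - k)) x) * sderiv k x))
       = - (\<Sum>k\<le>m. real (m choose k) * (sderiv (Suc k) x * sderiv (m - k) x + sderiv k x * sderiv (Suc (m - k)) x))"
      by (simp add: sum_negf[symmetric] algebra_simps)
    also have "\<dots> = - (\<Sum>k\<le>Suc m. real (Suc m choose k) * (sderiv k x * sderiv (Suc m - k) x))"
      by (subst sum_binomial_Leibniz) simp
    also have "real m * (- sderiv (Suc m) x) + \<dots> - (- forcing (Suc m) x) = sderiv (Suc m) x - x * sderiv (Suc (Suc m)) x"
      using sderiv_recursion[OF less.prems, of "Suc m"] by (simp add: algebra_simps)
    finally have R: "(R has_real_derivative sderiv (Suc m) x - x * sderiv (Suc (Suc m)) x) (at x)" .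
    have "sderiv (Suc m) = (\<lambda>x. R x / x)"
      by (auto simp: R_def sderiv.simps(2))
    moreover have "R x = x * sderiv (Suc m) x"
      using sderiv_recursion[OF less.prems] by (simp add: R_def)
    ultimately show ?thesis
      using less.prems Suc
      by (auto intro!: derivative_eq_intros R simp: divide_simps)
  qed
qed

lemma sderiv_growth: "poly_growth (sderiv n)"
proof (induction n rule: less_induct)
  case (less n)
  show ?case
  proof (cases n)
    case 0
    have "sderiv 0 = (\<lambda>x. - v x)" by auto
    then show ?thesis using 0 v_growth by (auto intro: poly_growth_uminus)
  next
    case (Suc m)
    have sderiv: "sderiv (Suc m) = (\<lambda>x. (real m * sderiv m x + (\<Sum>k\<le>m. real (m choose k) * (sderiv k x * sderiv (m - k) x))
        + - forcing m x) / x)"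
      by (auto simp: sderiv.simps(2))
    have "poly_growth (\<lambda>x. p * x + q)"
      by (intro poly_growth_const poly_growth_add poly_growth_mult poly_growth_ident)
    then have "poly_growth (forcing m)"
      unfolding forcing_def[abs_def] by (cases "m = 0"; cases "m = 1") (auto intro: poly_growth_const)
    then show ?thesis
      unfolding Suc sderiv using less Suc
      by (intro poly_growth_divide_ident poly_growth_add poly_growth_mult poly_growth_sum
          poly_growth_const poly_growth_uminus) auto
  qed
qed

lemma decay_growth:
  assumes "poly_growth f"
  shows "((\<lambda>x. x ^ n * (u x)\<^sup>2 * f x) \<longlongrightarrow> 0) at_top"
proof -
  obtain C m where C: "0 \<le> C" "\<forall>x\<ge>1. \<bar>f x\<bar> \<le> C * x ^ m"
    using assms unfolding poly_growth_def by blast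
  have lim: "((\<lambda>x. C * (x ^ (n + m) * (u x)\<^sup>2)) \<longlongrightarrow> 0) at_top"
    by (intro tendsto_mult_right_zero u_decay)
  have "norm (x ^ n * (u x)\<^sup>2 * f x) \<le> C * (x ^ (n + m) * (u x)\<^sup>2)" if "x \<ge> 1" for x
  proof -
    have "x ^ n * (u x)\<^sup>2 * \<bar>f x\<bar> \<le> x ^ n * (u x)\<^sup>2 * (C * x ^ m)"
      using C that by (intro mult_left_mono) auto
    then show ?thesis using that by (simp add: abs_mult power_add mult_ac)
  qed
  then have "\<forall>\<^sub>F x in at_top. norm (x ^ n * (u x)\<^sup>2 * f x) \<le> C * (x ^ (n + m) * (u x)\<^sup>2)"
    by (rule eventually_mono[OF eventually_ge_at_top])
  then show ?thesis using lim by (rule Lim_null_comparison)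
qed

text \<open>
  \<open>x\<^sup>n u\<^sup>2\<close> is an integrating factor of the linear equation satisfied by \<open>sderiv n\<close>, whose
  inhomogeneous term has a sign by induction. The product with the integrating factor is therefore
  monotone, and its limit \<open>0\<close> at infinity fixes the sign.
\<close>
lemma sderiv_nonneg: "1 \<le> n \<Longrightarrow> 0 < x \<Longrightarrow> 0 \<le> sderiv n x"
proof (induction n arbitrary: x rule: less_induct)
  case (less n)
  define Q where "Q = (\<lambda>x. x ^ n * (u x)\<^sup>2 * sderiv n x)"
  have Q': "\<exists>d. (Q has_real_derivative d) (at y) \<and> d \<le> 0" if y: "0 < y" for y
  proof -
    (* The terms k = 0 and k = n of the Leibniz sum contain sderiv n and are kept apart. *)
    define T where "T = (\<Sum>k\<in>{1..<n}. real (n choose k) * (sderiv k y * sderiv (n - k) y)) - forcing n y"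
    have "0 \<le> sderiv k y * sderiv (n - k) y" if "k \<in> {1..<n}" for k
      using less.IH[of k y] less.IH[of "n - k" y] that y by auto
    then have "0 \<le> (\<Sum>k\<in>{1..<n}. real (n choose k) * (sderiv k y * sderiv (n - k) y))"
      by (intro sum_nonneg mult_nonneg_nonneg[of "real _"]) auto
    then have T: "0 \<le> T"
      using less.prems p_nonneg by (auto simp: T_def forcing_def)
    have "{..n} = insert 0 (insert n {1..<n})" using less.prems by auto
    then have "(\<Sum>k\<le>n. real (n choose k) * (sderiv k y * sderiv (n - k) y)) = 2 * (sderiv 0 y * sderiv n y) + (T + forcing n y)"
      using less.prems unfolding T_def by simp
    then have rec: "y * sderiv (Suc n) y = real n * sderiv n y + 2 * (sderiv 0 y * sderiv n y) + T"
      using sderiv_recursion[OF y, of n] by simp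
    obtain m where n: "n = Suc m" using less.prems by (cases n) auto
    have "((\<lambda>y. u y ^ 2) has_real_derivative real 2 * (- u y * v y / y * u y ^ (2 - Suc 0))) (at y)"
      by (rule DERIV_power[OF u_deriv[OF y]])
    from DERIV_mult[OF DERIV_mult[OF DERIV_pow[of n y] this] sderiv_deriv[OF y, of n]]
    have "(Q has_real_derivative (real n * y ^ m * (u y)\<^sup>2
        + 2 * u y * (- u y * v y / y) * y ^ n) * sderiv n y - sderiv (Suc n) y * (y ^ n * (u y)\<^sup>2)) (at y)"
      unfolding Q_def by (rule DERIV_cong) (simp add: n)
    also have "2 * u y * (- u y * v y / y) * y ^ n = - 2 * y ^ m * (u y)\<^sup>2 * v y"
      using y by (simp add: n power2_eq_square)
    also have "(real n * y ^ m * (u y)\<^sup>2 + - 2 * y ^ m * (u y)\<^sup>2 * v y) * sderiv n y - sderiv (Suc n) y * (y ^ n * (u y)\<^sup>2)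
        = y ^ m * (u y)\<^sup>2 * (real n * sderiv n y + 2 * (sderiv 0 y * sderiv n y) - y * sderiv (Suc n) y)"
      unfolding n by (simp add: algebra_simps)
    also have "\<dots> = - (y ^ m * (u y)\<^sup>2 * T)"
      unfolding rec by simp
    finally show ?thesis
      using T y by (intro exI[of _ "- (y ^ m * (u y)\<^sup>2 * T)"]) auto
  qed
  have lim: "(Q \<longlongrightarrow> 0) at_top"
    unfolding Q_def by (intro decay_growth sderiv_growth)
  have "\<forall>\<^sub>F y in at_top. Q y \<le> Q x"
    using eventually_ge_at_top[of x]
  proof eventually_elim
    case (elim y)
    show ?case
    proof (rule DERIV_nonpos_imp_nonincreasing[OF elim])
      fix t assume "x \<le> t"
      then have "0 < t" using less.prems by simp
      then show "\<exists>d. (Q has_real_derivative d) (at t) \<and> d \<le> 0" by (rule Q')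
    qed
  qed
  then have "0 \<le> Q x"
    using lim by (intro tendsto_upperbound[of Q 0 at_top]) auto
  moreover have "0 < x ^ n * (u x)\<^sup>2"
    using less.prems u_pos[of x] by simp
  ultimately show ?case
    using mult_pos_neg[of "x ^ n * (u x)\<^sup>2" "sderiv n x"] unfolding Q_def by linarith
qed

text \<open>
  \<open>qderiv n\<close> is \<open>(-1)\<^sup>n\<close> times the \<open>n\<close>-th derivative of \<open>v / x\<close>; the recursion is the Leibniz rule
  for \<open>v = x (v / x)\<close>.
\<close>
fun qderiv :: "nat \<Rightarrow> real \<Rightarrow> real" where
  "qderiv 0 x = v x / x"
| "qderiv (Suc n) x = (real (Suc n) * qderiv n x - sderiv (Suc n) x) / x"

lemma qderiv_deriv: "0 < x \<Longrightarrow> (qderiv n has_real_derivative - qderiv (Suc n) x) (at x)"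
proof (induction n arbitrary: x)
  case 0
  have "qderiv 0 = (\<lambda>x. v x / x)" by auto
  then show ?case
    using 0 by (auto intro!: derivative_eq_intros v_deriv simp: divide_simps sderiv.simps(2) forcing_def)
       (auto simp: algebra_simps power2_eq_square)
next
  case (Suc n)
  have "qderiv (Suc n) = (\<lambda>x. (real (Suc n) * qderiv n x - sderiv (Suc n) x) / x)" by auto
  then show ?case
    using Suc.prems
    by (auto intro!: derivative_eq_intros Suc.IH sderiv_deriv simp del: qderiv.simps)
      (simp add: field_simps)
qed

text \<open>
  The Taylor polynomial of \<open>v\<close> of degree \<open>n\<close> about \<open>x\<close>, evaluated at \<open>0\<close>, is \<open>x\<^bsup>n+1\<^esup> / n!\<close> times
  \<open>qderiv n x\<close>. Evaluated at \<open>y\<close> with \<open>0 < y < x\<close>, this polynomial is at least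
  \<open>v y \<ge> 0\<close> because the remainder has the sign of \<open>- sderiv (n + 1)\<close>. Then let \<open>y\<close> tend to \<open>0\<close>.
\<close>
lemma qderiv_nonneg: "0 < x \<Longrightarrow> 0 \<le> qderiv n x"
proof -
  assume x: "0 < x"
  (* G z is the Taylor polynomial about x, evaluated at x - z. *)
  define G where "G = (\<lambda>z. - (\<Sum>k\<le>n. sderiv k x * z ^ k / fact k))"
  have G: "G x = qderiv n x * x ^ Suc n / fact n"
    unfolding G_def
  proof (induction n)
    case 0
    then show ?case using x by simp
  next
    case (Suc n)
    have "qderiv (Suc n) x * x ^ Suc (Suc n) / fact (Suc n)
        = (real (Suc n) * qderiv n x - sderiv (Suc n) x) * x ^ Suc n / (real (Suc n) * fact n)"
      using x by (simp add: mult_ac)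
    also have "\<dots> = qderiv n x * x ^ Suc n / fact n - sderiv (Suc n) x * x ^ Suc n / fact (Suc n)"
      by (simp only: left_diff_distrib diff_divide_distrib fact_Suc) simp
    finally show ?case using Suc by simp
  qed
  have "0 \<le> G (x - y)" if y: "0 < y" "y < x" for y
  proof -
    have "\<exists>t>y. t < x \<and> - v y = (\<Sum>m<Suc n. ((- 1) ^ m * sderiv m x) / fact m * (y - x) ^ m)
        + ((- 1) ^ Suc n * sderiv (Suc n) t) / fact (Suc n) * (y - x) ^ Suc n"
      by (rule Taylor_down[where b = x and diff = "\<lambda>m t. (- 1) ^ m * sderiv m t" and f = "\<lambda>x. - v x"])
         (use y in \<open>auto intro!: derivative_eq_intros sderiv_deriv\<close>)
    then obtain t where t: "y < t" "t < x" and
      eq: "- v y = (\<Sum>m<Suc n. ((- 1) ^ m * sderiv m x) / fact m * (y - x) ^ m)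
        + ((- 1) ^ Suc n * sderiv (Suc n) t) / fact (Suc n) * (y - x) ^ Suc n"
      by blast
    have pw: "(- 1) ^ m * w / f * (y - x) ^ m = w * (x - y) ^ m / f" for m and w f :: real
      using power_mult_distrib[of "- 1" "y - x" m] by (simp add: mult_ac)
    have "- v y = - G (x - y) + sderiv (Suc n) t * (x - y) ^ Suc n / fact (Suc n)"
      using eq unfolding pw G_def by (simp only: lessThan_Suc_atMost minus_minus)
    moreover have "0 \<le> sderiv (Suc n) t * (x - y) ^ Suc n / fact (Suc n)"
      using t y sderiv_nonneg[of "Suc n" t] by (intro divide_nonneg_nonneg mult_nonneg_nonneg) auto
    ultimately show ?thesis using v_nonneg[OF y(1)] by linarith
  qed
  then have "\<forall>\<^sub>F y in at_right 0. 0 \<le> G (x - y)"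
    using x by (auto simp: eventually_at_right_field)
  moreover have "((\<lambda>y. G (x - y)) \<longlongrightarrow> G (x - 0)) (at_right 0)"
    unfolding G_def by (intro tendsto_intros) auto
  ultimately have "0 \<le> G x"
    using tendsto_lowerbound[of "\<lambda>y. G (x - y)" "G (x - 0)" "at_right 0" 0] by auto
  then have "0 \<le> qderiv n x * (x ^ Suc n / fact n)" using G by simp
  moreover have "0 < x ^ Suc n / fact n" using x by simp
  ultimately show ?thesis using mult_neg_pos[of "qderiv n x" "x ^ Suc n / fact n"] by linarith
qed

theorem alternating_quotient: "alternating n {0<..} 1 (\<lambda>x. v x / x)"
proof -
  have "alternating n {0<..} 1 (qderiv 0)"
    by (rule alternating_sequence) (use qderiv_deriv qderiv_nonneg in auto)
  moreover have "qderiv 0 = (\<lambda>x. v x / x)" by auto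
  ultimately show ?thesis by simp
qed

end

section \<open>Moments of the Bessel kernel\<close>

text \<open>
  Up to the sign \<open>(-1)\<^sup>k\<close>, the \<open>k\<close>-th derivative of \<open>K\<^sub>\<alpha>\<close>.
\<close>
definition bessel_moment :: "nat \<Rightarrow> real \<Rightarrow> real \<Rightarrow> real" where
  "bessel_moment k \<alpha> s = (LBINT t:{0..}. exp (- s * cosh t) * cosh t ^ k * cosh (\<alpha> * t))"

lemma bessel_K_eq_moment: "bessel_K \<alpha> = bessel_moment 0 \<alpha>"
  by (auto simp: bessel_K_def bessel_moment_def)

lemma power_le_fact_mult_exp:
  fixes z :: real
  assumes "0 \<le> z"
  shows "z ^ n \<le> fact n * exp z"
proof -
  have "(\<Sum>k\<in>{n}. z ^ k /\<^sub>R fact k) \<le> (\<Sum>k. z ^ k /\<^sub>R fact k)"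
    using assms summable_exp_generic[of z] by (intro sum_le_suminf) auto
  then have "z ^ n / fact n \<le> exp z"
    by (simp add: exp_def divide_inverse mult.commute)
  then show ?thesis by (simp add: field_simps)
qed

lemma exp_le_two_cosh: "exp t \<le> 2 * cosh (t :: real)"
  by (simp add: cosh_def)

lemma cosh_le_exp: "0 \<le> t \<Longrightarrow> cosh t \<le> exp (t :: real)"
  by (simp add: cosh_def)

text \<open>
  In terms of \<open>y = cosh t\<close> one has \<open>exp t \<le> 2 y\<close>, so that the kernel times \<open>exp t\<close> is at most a
  constant times \<open>y ^ N * exp (- s y)\<close> for some \<open>N\<close>, which is bounded.
\<close>
lemma bessel_kernel_bound:
  fixes \<alpha> s :: real
  assumes "0 < s" "0 \<le> \<alpha>"
  shows "\<exists>B. \<forall>t\<ge>0. exp (- s * cosh t) * cosh t ^ k * cosh (\<alpha> * t) \<le> B * exp (- t)"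
proof -
  define m where "m = nat \<lceil>\<alpha>\<rceil>"
  define N where "N = k + Suc m"
  have "exp (- s * cosh t) * cosh t ^ k * cosh (\<alpha> * t) \<le> 2 ^ Suc m * fact N / s ^ N * exp (- t)"
    if t: "t \<ge> 0" for t
  proof -
    define y where "y = cosh t"
    have y: "1 \<le> y" by (simp add: y_def cosh_real_ge_1)
    have "cosh (\<alpha> * t) \<le> exp (\<alpha> * t)" using assms t by (intro cosh_le_exp) auto
    also have "\<dots> \<le> exp (real m * t)"
      using t unfolding m_def by (auto intro!: mult_right_mono) linarith
    also have "\<dots> = exp t ^ m" by (simp add: exp_of_nat_mult)
    finally have "cosh (\<alpha> * t) * exp t \<le> exp t ^ Suc m" by simp
    also have "\<dots> \<le> (2 * y) ^ Suc m"
      unfolding y_def by (intro power_mono exp_le_two_cosh) auto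
    finally have 1: "cosh (\<alpha> * t) * exp t \<le> (2 * y) ^ Suc m" .
    have "(s * y) ^ N \<le> fact N * exp (s * y)"
      using assms y by (intro power_le_fact_mult_exp) auto
    then have 2: "y ^ N * exp (- s * y) \<le> fact N / s ^ N"
      using assms by (simp add: power_mult_distrib exp_minus field_simps)
    have "exp (- s * y) * y ^ k * (cosh (\<alpha> * t) * exp t) \<le> exp (- s * y) * y ^ k * (2 * y) ^ Suc m"
      using 1 y by (intro mult_left_mono) auto
    also have "\<dots> = 2 ^ Suc m * (y ^ N * exp (- s * y))"
      by (simp add: N_def power_add power_mult_distrib)
    also have "\<dots> \<le> 2 ^ Suc m * (fact N / s ^ N)"
      using 2 by (intro mult_left_mono) auto
    finally have "exp (- s * y) * y ^ k * cosh (\<alpha> * t) * exp t \<le> 2 ^ Suc m * fact N / s ^ N"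
      by (simp add: mult_ac)
    moreover have "X \<le> M * exp (- t)" if "X * exp t \<le> M" for X M :: real
      using that by (simp add: exp_minus field_simps)
    ultimately show ?thesis unfolding y_def by blast
  qed
  then show ?thesis by blast
qed

lemma set_integrable_exp_minus: "set_integrable lborel {0..} (\<lambda>t::real. exp (- t))"
proof -
  have "(\<lambda>t::real. exp (- t)) integrable_on {0..}"
    using integrable_on_exp_minus_to_infinity[of 1 0] by simp
  then have "(\<lambda>t::real. exp (- t)) absolutely_integrable_on {0..}"
    by (intro nonnegative_absolutely_integrable_1) auto
  then show ?thesis
    unfolding set_integrable_def by (subst (asm) integrable_completion) auto
qed

lemma set_borel_measurable_kernel:
  "set_borel_measurable lborel {0..} (\<lambda>t::real. exp (- s * cosh t) * cosh t ^ k * cosh (\<alpha> * t))"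
proof -
  have "(\<lambda>t::real. exp (- s * cosh t) * cosh t ^ k * cosh (\<alpha> * t)) \<in> borel_measurable borel"
    by (intro borel_measurable_continuous_onI continuous_intros)
  then show ?thesis unfolding set_borel_measurable_def by measurable
qed

lemma bessel_kernel_integrable:
  fixes \<alpha> s :: real
  assumes "0 < s" "0 \<le> \<alpha>"
  shows "set_integrable lborel {0..} (\<lambda>t. exp (- s * cosh t) * cosh t ^ k * cosh (\<alpha> * t))"
proof -
  obtain B where B: "\<forall>t\<ge>0. exp (- s * cosh t) * cosh t ^ k * cosh (\<alpha> * t) \<le> B * exp (- t)"
    using bessel_kernel_bound[OF assms] by blast
  show ?thesis
  proof (rule set_integrable_bound)
    show "set_integrable lborel {0..} (\<lambda>t. B * exp (- t))"
      by (intro set_integrable_mult_right set_integrable_exp_minus)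
    show "AE t in lborel. t \<in> {0..} \<longrightarrow>
        norm (exp (- s * cosh t) * cosh t ^ k * cosh (\<alpha> * t)) \<le> norm (B * exp (- t))"
    proof (intro AE_I2 impI)
      fix t :: real assume "t \<in> {0..}"
      then have "exp (- s * cosh t) * cosh t ^ k * cosh (\<alpha> * t) \<le> B * exp (- t)"
        using B by simp
      moreover have "0 \<le> exp (- s * cosh t) * cosh t ^ k * cosh (\<alpha> * t)" by simp
      ultimately show "norm (exp (- s * cosh t) * cosh t ^ k * cosh (\<alpha> * t)) \<le> norm (B * exp (- t))"
        unfolding real_norm_def by linarith
    qed
  qed (rule set_borel_measurable_kernel)
qed

lemma exp_remainder_le:
  fixes z :: real
  shows "\<bar>exp z - 1 - z\<bar> \<le> z\<^sup>2 * exp \<bar>z\<bar>"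
proof -
  obtain t where t: "\<bar>t\<bar> \<le> \<bar>z\<bar>" "exp z = (\<Sum>m<2. z ^ m / fact m) + exp t / fact 2 * z ^ 2"
    using Maclaurin_exp_le by blast
  then have "exp z - 1 - z = exp t * z\<^sup>2 / 2"
    by (simp add: numeral_2_eq_2)
  moreover have "exp t * z\<^sup>2 \<le> exp \<bar>z\<bar> * z\<^sup>2"
    using t(1) by (intro mult_right_mono) auto
  moreover have "0 \<le> exp t * z\<^sup>2" by simp
  ultimately have "\<bar>exp z - 1 - z\<bar> \<le> exp \<bar>z\<bar> * z\<^sup>2" by linarith
  then show ?thesis by (simp only: mult.commute)
qed

lemma has_real_derivative_quadratic_remainder:
  fixes f :: "real \<Rightarrow> real"
  assumes "0 < d" and "\<And>h. \<bar>h\<bar> \<le> d \<Longrightarrow> \<bar>f (x + h) - f x - h * D\<bar> \<le> C * h\<^sup>2"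
  shows "(f has_real_derivative D) (at x)"
  unfolding DERIV_def
proof (subst LIM_zero_iff[symmetric], rule Lim_null_comparison)
  show "\<forall>\<^sub>F h in at 0. norm ((f (x + h) - f x) / h - D) \<le> C * \<bar>h\<bar>"
    unfolding eventually_at
  proof (intro exI[of _ d] conjI ballI impI)
    fix h :: real assume h: "h \<noteq> 0 \<and> dist h 0 < d"
    then have "\<bar>f (x + h) - f x - h * D\<bar> \<le> (C * \<bar>h\<bar>) * \<bar>h\<bar>"
      using assms(2)[of h] by (simp add: power2_eq_square mult_ac)
    then have "\<bar>f (x + h) - f x - h * D\<bar> / \<bar>h\<bar> \<le> C * \<bar>h\<bar>"
      using h by (simp add: divide_le_eq)
    moreover have "(f (x + h) - f x) / h - D = (f (x + h) - f x - h * D) / h"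
      using h by (simp add: field_simps)
    ultimately show "norm ((f (x + h) - f x) / h - D) \<le> C * \<bar>h\<bar>"
      by (simp add: abs_divide)
  qed (use assms in auto)
  show "((\<lambda>h. C * \<bar>h\<bar>) \<longlongrightarrow> 0) (at 0)"
    by (auto intro!: tendsto_eq_intros)
qed

text \<open>
  Differentiation under the integral sign, by integrating the pointwise bound of the second-order
  remainder. For increments up to \<open>s / 2\<close> the remainder is dominated by the kernel at \<open>s / 2\<close>.
\<close>
lemma bessel_moment_deriv:
  assumes "0 < s" "0 \<le> \<alpha>"
  shows "(bessel_moment k \<alpha> has_real_derivative - bessel_moment (Suc k) \<alpha> s) (at s)"
proof (rule has_real_derivative_quadratic_remainder)
  show "0 < s / 2" using assms by simp
  fix h :: real assume h: "\<bar>h\<bar> \<le> s / 2"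
  let ?E = "\<lambda>j s t. exp (- s * cosh t) * cosh t ^ j * cosh (\<alpha> * t)"
  note I = bessel_kernel_integrable[OF _ assms(2)]
  have pos: "0 < s + h" using h assms by linarith
  let ?R = "\<lambda>t. ?E k (s + h) t - ?E k s t + h * ?E (Suc k) s t"
  have i1: "set_integrable lborel {0..} (\<lambda>t. ?E k (s + h) t - ?E k s t)"
    using pos assms by (intro set_integral_diff I)
  have i2: "set_integrable lborel {0..} (\<lambda>t. h * ?E (Suc k) s t)"
    using assms by (intro set_integrable_mult_right I)
  have iR: "set_integrable lborel {0..} ?R"
    by (intro set_integral_add i1 i2)
  have "bessel_moment k \<alpha> (s + h) - bessel_moment k \<alpha> s - h * - bessel_moment (Suc k) \<alpha> s
      = (LBINT t:{0..}. ?R t)"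
    unfolding bessel_moment_def
    using set_integral_add(2)[OF i1 i2] set_integral_diff(2)[OF I[OF pos] I[OF assms(1)]]
    by (simp add: set_integral_mult_right)
  then have "\<bar>bessel_moment k \<alpha> (s + h) - bessel_moment k \<alpha> s - h * - bessel_moment (Suc k) \<alpha> s\<bar>
      \<le> (LBINT t:{0..}. norm (?R t))"
    using set_integral_norm_bound[OF iR] by simp
  also have "\<dots> \<le> (LBINT t:{0..}. h\<^sup>2 * ?E (Suc (Suc k)) (s / 2) t)"
  proof (rule set_integral_mono)
    show "set_integrable lborel {0..} (\<lambda>t. norm (?R t))"
      by (intro set_integrable_norm iR)
    show "set_integrable lborel {0..} (\<lambda>t. h\<^sup>2 * ?E (Suc (Suc k)) (s / 2) t)"
      using assms by (intro set_integrable_mult_right I) auto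
    fix t :: real
    define y where "y = cosh t"
    have y: "1 \<le> y" by (simp add: y_def cosh_real_ge_1)
    have "?R t = exp (- s * y) * y ^ k * cosh (\<alpha> * t) * (exp (- h * y) - 1 - (- h * y))"
      by (simp add: y_def algebra_simps exp_add[symmetric])
    then have "norm (?R t) = exp (- s * y) * y ^ k * cosh (\<alpha> * t) * \<bar>exp (- h * y) - 1 - (- h * y)\<bar>"
      using y by (simp add: abs_mult)
    also have "\<dots> \<le> exp (- s * y) * y ^ k * cosh (\<alpha> * t) * ((- h * y)\<^sup>2 * exp \<bar>- h * y\<bar>)"
      using y by (intro mult_left_mono exp_remainder_le) auto
    also have "\<dots> \<le> exp (- s * y) * y ^ k * cosh (\<alpha> * t) * ((- h * y)\<^sup>2 * exp (s / 2 * y))"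
      using y h by (intro mult_left_mono) (auto simp: abs_mult intro!: mult_right_mono)
    also have "\<dots> = h\<^sup>2 * (y ^ Suc (Suc k)) * cosh (\<alpha> * t) * (exp (- s * y) * exp (s / 2 * y))"
      by (simp add: power2_eq_square mult_ac)
    also have "exp (- s * y) * exp (s / 2 * y) = exp (- (s / 2) * y)"
      by (simp add: exp_add[symmetric] field_simps)
    finally show "norm (?R t) \<le> h\<^sup>2 * ?E (Suc (Suc k)) (s / 2) t"
      by (simp add: y_def mult_ac)
  qed
  also have "\<dots> = bessel_moment (Suc (Suc k)) \<alpha> (s / 2) * h\<^sup>2"
    unfolding bessel_moment_def by (simp add: set_integral_mult_right)
  finally show "\<bar>bessel_moment k \<alpha> (s + h) - bessel_moment k \<alpha> s - h * - bessel_moment (Suc k) \<alpha> s\<bar>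
      \<le> bessel_moment (Suc (Suc k)) \<alpha> (s / 2) * h\<^sup>2" .
qed

lemma set_integral_pos:
  fixes f :: "real \<Rightarrow> real"
  assumes int: "set_integrable lborel {0..} f" and pos: "\<And>t. 0 \<le> t \<Longrightarrow> 0 < f t"
  shows "0 < (LBINT t:{0..}. f t)"
proof -
  have nn: "\<And>t. 0 \<le> indicator {0..} t *\<^sub>R f t"
    using pos by (auto simp: indicator_def less_imp_le)
  have "(LBINT t:{0..}. f t) \<noteq> 0"
  proof
    assume "(LBINT t:{0..}. f t) = 0"
    then have "AE t in lborel. indicator {0..} t *\<^sub>R f t = 0"
      using integral_nonneg_eq_0_iff_AE[of lborel "\<lambda>t. indicator {0..} t *\<^sub>R f t"] int nn
      by (simp add: set_integrable_def set_lebesgue_integral_def)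
    then have "AE t in lborel. t \<notin> {0..1::real}"
      using pos by (auto simp: indicator_def elim!: eventually_mono split: if_splits) force
    then have "emeasure lborel {0..1::real} = 0"
      by (subst (asm) AE_iff_measurable[of "{0..1::real}"]) auto
    then show False by simp
  qed
  moreover have "0 \<le> (LBINT t:{0..}. f t)"
    using nn unfolding set_lebesgue_integral_def by (intro integral_nonneg_AE) auto
  ultimately show ?thesis by simp
qed

lemma bessel_moment_pos:
  assumes "0 < s" "0 \<le> \<alpha>"
  shows "0 < bessel_moment k \<alpha> s"
  unfolding bessel_moment_def
  by (intro set_integral_pos bessel_kernel_integrable assms) simp

text \<open>
  The modified Bessel equation \<open>s\<^sup>2 K'' + s K' = (s\<^sup>2 + \<alpha>\<^sup>2) K\<close>: the integrand of the difference of
  the two sides is an exact derivative in \<open>t\<close>, of a function that vanishes at \<open>0\<close> and at infinity.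
\<close>
lemma bessel_moment_equation:
  assumes "0 < s" "0 \<le> \<alpha>"
  shows "s\<^sup>2 * bessel_moment 2 \<alpha> s = s * bessel_moment 1 \<alpha> s + (s\<^sup>2 + \<alpha>\<^sup>2) * bessel_moment 0 \<alpha> s"
proof -
  let ?E = "\<lambda>j t. exp (- s * cosh t) * cosh t ^ j * cosh (\<alpha> * t)"
  note I = bessel_kernel_integrable[OF assms]
  define F where "F = (\<lambda>t. s * sinh t * exp (- s * cosh t) * cosh (\<alpha> * t) + \<alpha> * exp (- s * cosh t) * sinh (\<alpha> * t))"
  define f where "f = (\<lambda>t. (s * ?E 1 t + (s\<^sup>2 + \<alpha>\<^sup>2) * ?E 0 t) - s\<^sup>2 * ?E 2 t)"
  have i1: "set_integrable lborel {0..} (\<lambda>t. s * ?E 1 t)"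
    and i2: "set_integrable lborel {0..} (\<lambda>t. (s\<^sup>2 + \<alpha>\<^sup>2) * ?E 0 t)"
    and i3: "set_integrable lborel {0..} (\<lambda>t. s\<^sup>2 * ?E 2 t)"
    by (intro set_integrable_mult_right I)+
  have int: "set_integrable lborel {0..} f"
    unfolding f_def by (intro set_integral_diff set_integral_add i1 i2 i3)
  have F': "(F has_real_derivative f t) (at t)" for t
  proof -
    have sq: "sinh t * sinh t = cosh t * cosh t - 1"
      using hyperbolic_pythagoras[of t] by (simp add: power2_eq_square)
    have "(F has_real_derivative s * cosh t * exp (- s * cosh t) * cosh (\<alpha> * t)
        - s * s * (sinh t * sinh t) * exp (- s * cosh t) * cosh (\<alpha> * t)
        + \<alpha> * \<alpha> * exp (- s * cosh t) * cosh (\<alpha> * t)) (at t)"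
      unfolding F_def by (auto intro!: derivative_eq_intros simp: algebra_simps)
    then show ?thesis unfolding sq f_def by (simp add: algebra_simps power2_eq_square)
  qed
  have lim: "(F \<longlongrightarrow> 0) at_top"
  proof -
    obtain B where B: "\<forall>t\<ge>0. ?E 1 t \<le> B * exp (- t)"
      using bessel_kernel_bound[OF assms] by blast
    have "norm (F t) \<le> (s + \<alpha>) * B * exp (- t)" if t: "0 \<le> t" for t
    proof -
      have c: "1 \<le> cosh t" by (rule cosh_real_ge_1)
      have "\<bar>sinh t\<bar> \<le> cosh t" "\<bar>sinh (\<alpha> * t)\<bar> \<le> cosh (\<alpha> * t)"
        by (auto simp: sinh_def cosh_def abs_le_iff field_simps)
      have a: "\<bar>s * sinh t * exp (- s * cosh t) * cosh (\<alpha> * t)\<bar> \<le> s * ?E 1 t"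
        using \<open>\<bar>sinh t\<bar> \<le> cosh t\<close> assms
        by (auto simp: abs_mult mult_ac intro!: mult_left_mono)
      have "\<bar>sinh (\<alpha> * t)\<bar> \<le> cosh t * cosh (\<alpha> * t)"
        using mult_mono[OF c \<open>\<bar>sinh (\<alpha> * t)\<bar> \<le> cosh (\<alpha> * t)\<close>] by simp
      then have b: "\<bar>\<alpha> * exp (- s * cosh t) * sinh (\<alpha> * t)\<bar> \<le> \<alpha> * ?E 1 t"
        using assms by (auto simp: abs_mult mult_ac intro!: mult_left_mono)
      have "norm (F t) \<le> s * ?E 1 t + \<alpha> * ?E 1 t"
        using a b unfolding F_def real_norm_def by linarith
      also have "\<dots> = (s + \<alpha>) * ?E 1 t" by (simp add: distrib_right)
      also have "\<dots> \<le> (s + \<alpha>) * (B * exp (- t))"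
        using B t assms by (intro mult_left_mono) auto
      finally show ?thesis by (simp add: mult_ac)
    qed
    then have "\<forall>\<^sub>F t in at_top. norm (F t) \<le> (s + \<alpha>) * B * exp (- t)"
      by (rule eventually_mono[OF eventually_ge_at_top])
    moreover have "((\<lambda>t::real. exp (- t)) \<longlongrightarrow> 0) at_top"
      by (rule filterlim_compose[OF exp_at_bot filterlim_uminus_at_bot_at_top])
    then have "((\<lambda>t::real. (s + \<alpha>) * B * exp (- t)) \<longlongrightarrow> 0) at_top"
      by (rule tendsto_mult_right_zero)
    ultimately show ?thesis by (rule Lim_null_comparison)
  qed
  have "((\<lambda>T. LBINT t:{0..T}. f t) \<longlongrightarrow> (LBINT t:{0..}. f t)) at_top"
    by (rule tendsto_set_lebesgue_integral_at_top) (use int in auto)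
  moreover have "\<forall>\<^sub>F T in at_top. (LBINT t:{0..T}. f t) = F T"
    using eventually_ge_at_top[of 0]
  proof eventually_elim
    case (elim T)
    have "(LBINT t:{0..T}. f t) = F T - F 0"
      unfolding set_lebesgue_integral_def
      by (rule integral_FTC_Icc) (use elim F' in \<open>auto simp: has_real_derivative_iff_has_vector_derivative[symmetric] f_def
           intro: has_field_derivative_at_within intro!: continuous_intros\<close>)
    then show ?case by (simp add: F_def)
  qed
  ultimately have "(F \<longlongrightarrow> (LBINT t:{0..}. f t)) at_top"
    by (rule Lim_transform_eventually)
  then have "(LBINT t:{0..}. f t) = 0"
    using lim by (rule tendsto_unique[OF trivial_limit_at_top_linorder])
  moreover have "(LBINT t:{0..}. f t)
      = s * bessel_moment 1 \<alpha> s + (s\<^sup>2 + \<alpha>\<^sup>2) * bessel_moment 0 \<alpha> s - s\<^sup>2 * bessel_moment 2 \<alpha> s"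
    unfolding f_def bessel_moment_def
    using set_integral_diff(2)[OF set_integral_add(1)[OF i1 i2] i3] set_integral_add(2)[OF i1 i2]
    by (simp add: set_integral_mult_right)
  ultimately show ?thesis by simp
qed

text \<open>
  The kernel times \<open>(a * cosh t - b)\<^sup>2\<close> has a nonnegative integral; the choice \<open>a = K\<close>, \<open>b = - K'\<close>
  is the optimal one.
\<close>
lemma bessel_moment_Cauchy_Schwarz:
  assumes "0 < s" "0 \<le> \<alpha>"
  shows "(bessel_moment 1 \<alpha> s)\<^sup>2 \<le> bessel_moment 0 \<alpha> s * bessel_moment 2 \<alpha> s"
proof -
  let ?E = "\<lambda>j t. exp (- s * cosh t) * cosh t ^ j * cosh (\<alpha> * t)"
  note I = bessel_kernel_integrable[OF assms]
  define a b where "a = bessel_moment 0 \<alpha> s" and "b = bessel_moment 1 \<alpha> s"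
  have a: "0 < a" unfolding a_def using assms by (rule bessel_moment_pos)
  have i1: "set_integrable lborel {0..} (\<lambda>t. a\<^sup>2 * ?E 2 t)"
    and i2: "set_integrable lborel {0..} (\<lambda>t. (2 * a * b) * ?E 1 t)"
    and i3: "set_integrable lborel {0..} (\<lambda>t. b\<^sup>2 * ?E 0 t)"
    by (intro set_integrable_mult_right I)+
  have "0 \<le> (LBINT t:{0..}. ?E 0 t * (a * cosh t - b)\<^sup>2)"
    unfolding set_lebesgue_integral_def by (intro integral_nonneg_AE) auto
  also have "(\<lambda>t. ?E 0 t * (a * cosh t - b)\<^sup>2)
      = (\<lambda>t. (a\<^sup>2 * ?E 2 t - (2 * a * b) * ?E 1 t) + b\<^sup>2 * ?E 0 t)"
    by (auto simp: power2_eq_square algebra_simps)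
  also have "(LBINT t:{0..}. (a\<^sup>2 * ?E 2 t - (2 * a * b) * ?E 1 t) + b\<^sup>2 * ?E 0 t)
      = a\<^sup>2 * bessel_moment 2 \<alpha> s - (2 * a * b) * b + b\<^sup>2 * a"
    using set_integral_add(2)[OF set_integral_diff(1)[OF i1 i2] i3] set_integral_diff(2)[OF i1 i2]
    by (simp add: set_integral_mult_right a_def b_def bessel_moment_def)
  also have "\<dots> = a * (a * bessel_moment 2 \<alpha> s - b\<^sup>2)"
    by (simp add: power2_eq_square algebra_simps)
  finally show ?thesis
    using a by (simp add: zero_le_mult_iff a_def b_def)
qed

lemma bessel_moment_exp_decay:
  assumes "1 \<le> s" "0 \<le> \<alpha>"
  shows "bessel_moment 0 \<alpha> s \<le> exp (1 - s) * bessel_moment 0 \<alpha> 1"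
proof -
  let ?E = "\<lambda>s t. exp (- s * cosh t) * cosh t ^ 0 * cosh (\<alpha> * t)"
  have "(LBINT t:{0..}. ?E s t) \<le> (LBINT t:{0..}. exp (1 - s) * ?E 1 t)"
  proof (rule set_integral_mono)
    fix t :: real
    have "(s - 1) * 1 \<le> (s - 1) * cosh t"
      using assms by (intro mult_left_mono cosh_real_ge_1) auto
    then have "exp (- s * cosh t) \<le> exp ((1 - s) + (- 1 * cosh t))"
      by (simp add: algebra_simps)
    also have "\<dots> = exp (1 - s) * exp (- 1 * cosh t)" by (rule exp_add)
    finally show "?E s t \<le> exp (1 - s) * ?E 1 t"
      by (simp add: mult_right_mono)
  qed (use assms in \<open>intro set_integrable_mult_right bessel_kernel_integrable; simp\<close>)+
  then show ?thesis
    unfolding bessel_moment_def by (simp add: set_integral_mult_right)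
qed

section \<open>The logarithm of the Bessel function\<close>

text \<open>
  In the variable \<open>s = sqrt x\<close> one has \<open>v = - s K' / (2 K)\<close>, and the Riccati equation is the
  modified Bessel equation. The quotient \<open>- K' / K\<close> is bounded for \<open>s \<ge> 1\<close>: by
  \<open>K'\<^sup>2 \<le> K K''\<close> and the Bessel equation, its square is at most itself plus \<open>1 + \<alpha>\<^sup>2\<close>.
\<close>
lemma bessel_K_sqrt_riccati:
  fixes \<alpha> :: real
  assumes "0 \<le> \<alpha>"
  shows "riccati (\<lambda>x. bessel_K \<alpha> (sqrt x))
    (\<lambda>x. sqrt x * bessel_moment 1 \<alpha> (sqrt x) / (2 * bessel_K \<alpha> (sqrt x))) (1 / 4) (\<alpha>\<^sup>2 / 4)"
    (is "riccati ?u ?v _ _")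
proof
  let ?m = "\<lambda>k x. bessel_moment k \<alpha> (sqrt x)"
  have m_pos: "0 < ?m k x" if "0 < x" for k x
    using bessel_moment_pos assms that by simp
  have m_deriv: "((\<lambda>x. ?m k x) has_real_derivative - ?m (Suc k) x / (2 * sqrt x)) (at x)" if "0 < x" for k x
  proof -
    have "0 < sqrt x" using that by simp
    from DERIV_chain2[OF bessel_moment_deriv[OF this assms, of k] DERIV_real_sqrt[OF that]]
    show ?thesis by (rule DERIV_cong) (use that in \<open>simp add: field_simps\<close>)
  qed
  fix x :: real
  { assume x: "0 < x"
    define s where "s = sqrt x"
    have s: "0 < s" "x = s\<^sup>2" using x by (auto simp: s_def)
    define a b where "a = ?m 0 x" and "b = ?m 1 x"
    have a: "0 < a" and b: "0 < b" using m_pos[OF x] by (auto simp: a_def b_def)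
    show "0 < ?u x" "0 \<le> ?v x"
      using m_pos[OF x] x by (auto simp: bessel_K_eq_moment less_imp_le)
    show "(?u has_real_derivative - ?u x * ?v x / x) (at x)"
      unfolding bessel_K_eq_moment
      by (rule DERIV_cong[OF m_deriv[OF x, of 0]])
        (use m_pos[OF x, of 0] s in \<open>simp add: s_def[symmetric] power2_eq_square\<close>)
    have eq: "s\<^sup>2 * ?m 2 x = s * b + (s\<^sup>2 + \<alpha>\<^sup>2) * a"
      using bessel_moment_equation[of s \<alpha>] s(1) assms by (simp add: a_def b_def s_def)
    have "(?v has_real_derivative
        ((inverse s / 2 * b + - ?m 2 x / (2 * s) * s) * (2 * a) - s * b * (2 * (- b / (2 * s)))) / (2 * a * (2 * a))) (at x)"
      unfolding bessel_K_eq_moment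
      using DERIV_divide[OF DERIV_mult[OF DERIV_real_sqrt[OF x] m_deriv[OF x, of 1]]
          DERIV_cmult[OF m_deriv[OF x, of 0], of 2]] a
      by (simp add: a_def b_def s_def numeral_2_eq_2)
    moreover have "((inverse s / 2 * b + - ?m 2 x / (2 * s) * s) * (2 * a) - s * b * (2 * (- b / (2 * s)))) / (2 * a * (2 * a))
        = ((?v x)\<^sup>2 - 1 / 4 * x - \<alpha>\<^sup>2 / 4) / x"
    proof -
      have m2: "?m 2 x = (s * b + (s\<^sup>2 + \<alpha>\<^sup>2) * a) / s\<^sup>2"
        using eq s by (simp add: field_simps)
      have v: "?v x = s * b / (2 * a)" by (simp add: bessel_K_eq_moment a_def b_def s_def)
      show ?thesis
        unfolding m2 v using s a by (simp add: field_simps power2_eq_square)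
    qed
    ultimately show "(?v has_real_derivative ((?v x)\<^sup>2 - 1 / 4 * x - \<alpha>\<^sup>2 / 4) / x) (at x)"
      by simp }
  show "poly_growth ?v"
    unfolding poly_growth_def
  proof (intro exI[of _ "2 + \<alpha>\<^sup>2"] exI[of _ 1] conjI allI impI)
    fix x :: real assume x: "1 \<le> x"
    define s where "s = sqrt x"
    have s: "1 \<le> s" "x = s\<^sup>2" using x by (auto simp: s_def)
    define a b d where "a = ?m 0 x" and "b = ?m 1 x" and "d = ?m 2 x"
    have pos: "0 < a" "0 < b" using m_pos x by (auto simp: a_def b_def)
    have eq: "s\<^sup>2 * d = s * b + (s\<^sup>2 + \<alpha>\<^sup>2) * a"
      using bessel_moment_equation[of s \<alpha>] s(1) assms by (simp add: a_def b_def d_def s_def)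
    have "b\<^sup>2 \<le> a * d"
      using bessel_moment_Cauchy_Schwarz[of s \<alpha>] s(1) assms by (simp add: a_def b_def d_def s_def)
    moreover have "d \<le> b + (1 + \<alpha>\<^sup>2) * a"
    proof -
      have "s * b \<le> s\<^sup>2 * b" "\<alpha>\<^sup>2 * a \<le> s\<^sup>2 * (\<alpha>\<^sup>2 * a)"
        using s pos mult_right_mono[OF one_le_power[OF s(1), of 2], of "\<alpha>\<^sup>2 * a"]
        by (auto simp: power2_eq_square)
      then have "s\<^sup>2 * d \<le> s\<^sup>2 * (b + (1 + \<alpha>\<^sup>2) * a)"
        unfolding eq by (simp add: algebra_simps)
      then show ?thesis using s by simp
    qed
    ultimately have "b\<^sup>2 \<le> a * (b + (1 + \<alpha>\<^sup>2) * a)"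
      using pos by (meson mult_left_mono less_imp_le order_trans)
    have "b \<le> (2 + \<alpha>\<^sup>2) * a"
    proof (rule ccontr)
      assume "\<not> ?thesis"
      then have *: "(2 + \<alpha>\<^sup>2) * a < b" by simp
      then have "(1 + \<alpha>\<^sup>2) * a < b - a" by (simp add: algebra_simps)
      moreover have "1 * a \<le> (2 + \<alpha>\<^sup>2) * a" using pos by (intro mult_right_mono) auto
      with * have "a < b" by simp
      ultimately have "a * ((1 + \<alpha>\<^sup>2) * a) < b * (b - a)"
        using pos by (intro mult_strict_mono) auto
      with \<open>b\<^sup>2 \<le> a * (b + (1 + \<alpha>\<^sup>2) * a)\<close> show False
        by (simp add: algebra_simps power2_eq_square)
    qed
    have "?v x = s * b / (2 * a)" by (simp add: bessel_K_eq_moment a_def b_def s_def)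
    also have "\<dots> \<le> s * ((2 + \<alpha>\<^sup>2) * a) / (2 * a)"
      using s pos \<open>b \<le> (2 + \<alpha>\<^sup>2) * a\<close> by (intro divide_right_mono mult_left_mono) auto
    also have "\<dots> = (2 + \<alpha>\<^sup>2) * (s / 2)" using pos by simp
    also have "\<dots> \<le> (2 + \<alpha>\<^sup>2) * x ^ 1"
    proof (rule mult_left_mono)
      have "s * 1 \<le> s * s" using s by (intro mult_left_mono) auto
      then show "s / 2 \<le> x ^ 1" using s by (simp add: power2_eq_square)
    qed simp
    finally have "?v x \<le> (2 + \<alpha>\<^sup>2) * x ^ 1" .
    moreover have "0 \<le> ?v x" using m_pos x by (auto simp: bessel_K_eq_moment less_imp_le)
    ultimately show "\<bar>?v x\<bar> \<le> (2 + \<alpha>\<^sup>2) * x ^ 1" by simp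
  qed simp
  show "((\<lambda>x. x ^ m * (?u x)\<^sup>2) \<longlongrightarrow> 0) at_top" for m
  proof (rule Lim_null_comparison)
    define C where "C = (bessel_moment 0 \<alpha> 1)\<^sup>2 * exp 2"
    have "norm (x ^ m * (?u x)\<^sup>2) \<le> C * (sqrt x ^ (2 * m) / exp (sqrt x))" if x: "1 \<le> x" for x
    proof -
      have "0 \<le> ?u x" using m_pos[of x 0] x by (simp add: bessel_K_eq_moment)
      moreover have "?u x \<le> exp (1 - sqrt x) * bessel_moment 0 \<alpha> 1"
        unfolding bessel_K_eq_moment using assms x by (intro bessel_moment_exp_decay) auto
      ultimately have "(?u x)\<^sup>2 \<le> (exp (1 - sqrt x) * bessel_moment 0 \<alpha> 1)\<^sup>2"
        by (intro power_mono)
      also have "\<dots> = exp (2 - 2 * sqrt x) * (bessel_moment 0 \<alpha> 1)\<^sup>2"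
        by (simp add: power_mult_distrib exp_double[symmetric] algebra_simps)
      also have "\<dots> \<le> exp (2 - sqrt x) * (bessel_moment 0 \<alpha> 1)\<^sup>2"
        using x by (intro mult_right_mono) auto
      also have "\<dots> = C / exp (sqrt x)"
        by (simp add: C_def exp_diff)
      finally have "x ^ m * (?u x)\<^sup>2 \<le> x ^ m * (C / exp (sqrt x))"
        using x by (intro mult_left_mono) auto
      moreover have "x ^ m = sqrt x ^ (2 * m)"
        using x by (simp add: power_mult)
      ultimately show ?thesis using x by (simp add: mult_ac)
    qed
    then show "\<forall>\<^sub>F x in at_top. norm (x ^ m * (?u x)\<^sup>2) \<le> C * (sqrt x ^ (2 * m) / exp (sqrt x))"
      by (rule eventually_mono[OF eventually_ge_at_top])
    show "((\<lambda>x. C * (sqrt x ^ (2 * m) / exp (sqrt x))) \<longlongrightarrow> 0) at_top"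
      by (intro tendsto_mult_right_zero filterlim_compose[OF tendsto_power_div_exp_0 sqrt_at_top])
  qed
qed simp

text \<open>
  Reciprocals of positive functions with completely monotonic derivative \<open>b\<close> are logarithmically
  completely monotonic, since \<open>(ln (1 / h))' = - b * (1 / h)\<close> is minus a product of two completely
  monotonic functions.
\<close>
lemma log_completely_monotonic_on_inverse:
  assumes S: "open S"
    and h_pos: "\<And>x. x \<in> S \<Longrightarrow> 0 < h x"
    and h_deriv: "\<And>x. x \<in> S \<Longrightarrow> (h has_real_derivative b x) (at x)"
    and b: "\<And>n. alternating n S 1 b"
  shows "log_completely_monotonic_on (\<lambda>x. 1 / h x) S"
  unfolding log_completely_monotonic_on_def
proof (intro conjI allI ballI impI)
  note inv = alternating_inverse[of S h b, OF h_pos h_deriv b]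
  fix x assume x: "x \<in> S"
  show "0 < 1 / h x" using h_pos[OF x] by simp
  show "(deriv ^^ n) (\<lambda>x. 1 / h x) field_differentiable at x" for n
    using alternating_iterated_deriv[OF S, of 1 n, OF inv] x
    by (auto simp: field_differentiable_def)
  fix n :: nat assume n: "1 \<le> n"
  have quot: "alternating n S (- 1) (\<lambda>x. - (b x * (1 / h x)))" for n
    using alternating_uminus[OF alternating_mult[OF b inv]] by simp
  obtain m where m: "n = Suc m" using n by (cases n) auto
  have "- (b y * (1 / h y)) = deriv (\<lambda>y. ln (1 / h y)) y" if y: "y \<in> S" for y
  proof -
    have "((\<lambda>y. ln (1 / h y)) has_real_derivative - (b y * (1 / h y))) (at y)"
      using h_pos[OF y] h_deriv[OF y]
      by (auto intro!: derivative_eq_intros simp: power2_eq_square)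
    then show ?thesis by (rule DERIV_imp_deriv[symmetric])
  qed
  then have "alternating (0 + m) S (- 1) (deriv (\<lambda>y. ln (1 / h y)))"
    using alternating_cong[OF S _ quot] by simp
  from alternating_sign[OF alternating_iterated_deriv[OF S this] x]
  show "0 \<le> (- 1) ^ n * (deriv ^^ n) (\<lambda>y. ln (1 / h y)) x"
    by (simp add: m funpow_swap1)
qed

theorem proposition7:
  fixes \<alpha> x0 :: real
  assumes "\<alpha> > 0"
    and "x0 > 0"
    and "bessel_K \<alpha> (sqrt x0) = 1"
  shows "log_completely_monotonic_on (bessel_Delta \<alpha>) {x0<..}"
proof -
  let ?u = "\<lambda>x. bessel_K \<alpha> (sqrt x)"
  let ?v = "\<lambda>x. sqrt x * bessel_moment 1 \<alpha> (sqrt x) / (2 * ?u x)"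
  interpret riccati ?u ?v "1 / 4" "\<alpha>\<^sup>2 / 4"
    using assms(1) by (intro bessel_K_sqrt_riccati) simp
  have less_1: "?u x < 1" if x: "x \<in> {x0<..}" for x
  proof -
    have "bessel_moment 0 \<alpha> (sqrt x) < bessel_moment 0 \<alpha> (sqrt x0)"
    (* The derivative of K is minus the first moment, which is positive. *)
    proof (rule DERIV_neg_imp_decreasing[where f = "bessel_moment 0 \<alpha>"])
      fix s assume "sqrt x0 \<le> s"
      then have "0 < s" using assms(2) by (meson less_le_trans real_sqrt_gt_zero)
      then show "\<exists>y. (bessel_moment 0 \<alpha> has_real_derivative y) (at s) \<and> y < 0"
        using bessel_moment_deriv[of s \<alpha> 0] bessel_moment_pos[of s \<alpha> 1] assms(1) by fastforce
    qed (use x in auto)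
    then show ?thesis using assms(3) by (simp add: bessel_K_eq_moment)
  qed
  have "log_completely_monotonic_on (\<lambda>x. 1 / - ln (?u x)) {x0<..}"
  proof (rule log_completely_monotonic_on_inverse)
    fix x assume x: "x \<in> {x0<..}"
    then have pos: "0 < x" "0 < ?u x" using assms(2) u_pos by auto
    show "0 < - ln (?u x)" using pos less_1[OF x] by simp
    show "((\<lambda>x. - ln (?u x)) has_real_derivative ?v x / x) (at x)"
      by (rule DERIV_cong[OF DERIV_minus[OF DERIV_chain2[OF DERIV_ln[OF pos(2)] u_deriv[OF pos(1)]]]])
        (use pos in \<open>simp add: field_simps\<close>)
  next
    show "alternating n {x0<..} 1 (\<lambda>x. ?v x / x)" for n
      by (rule alternating_subset[OF alternating_quotient]) (use assms(2) in auto)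
  qed simp
  then show ?thesis
    by (simp add: bessel_Delta_def[abs_def])
qed

end
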